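(* Let $\Gamma$ be the Coxeter graph, regarded as a digraph. Then $\Gamma$ is a $\{\vec{C}_7\}_{\vec{P}_3}$-UH digraph.
   Context: The Coxeter graph $\Gamma$ is the cubic graph on $28$ vertices $u_x, v_x, t_x, z_x$ ($x\in\mathbb{Z}_7$) with the following edges. The three $7$-cycles $(u_1u_2u_3u_4u_5u_6u_0)$, $(v_4v_6v_1v_3v_5v_0v_2)$, $(t_3t_6t_2t_5t_1t_4t_0)$, where consecutive vertices are adjacent and the last vertex is adjacent to the first. In addition, for each $x\in\mathbb{Z}_7$, the vertex $z_x$ is adjacent to $u_x, v_x, t_x$. A graph is regarded as a digraph by replacing each edge $\{u,v\}$ by the two oppositely oriented arcs $(u,v)$ and $(v,u)$. $\vec{C}_7$ denotes the oriented $7$-cycle, and $\vec{P}_3$ the directed path with $3$ vertices (a $2$-arc). For a digraph $\vec{H}$, a digraph $G$ is $\vec{H}$-UH if every isomorphism between two copies of $\vec{H}$ in $G$ extends to an automorphism of $G$. For a subdigraph $\vec{M}$ of $\vec{H}$, the graph $G$ is a $\{\vec{H}\}_{\vec{M}}$-UH digraph if all of the following hold: - $G$ is both $\vec{M}$-UH and $\vec{H}$-UH; - for every copy $\vec{H}_0$ of $\vec{H}$ in $G$ and every copy $\vec{M}_0$ of $\vec{M}$ contained in $\vec{H}_0$, there is exactly one copy $\vec{H}_1\neq\vec{H}_0$ of $\vec{H}$ in $G$ with $V(\vec{H}_0)\cap V(\vec{H}_1)=V(\vec{M}_0)$ and $A(\vec{H}_0)\cap \bar{A}(\vec{H}_1)=A(\vec{M}_0)$.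 Here $A(\cdot)$ is the arc set, and $\bar{A}(\vec{H}_1)=\{(w,u): (u,w)\in A(\vec{H}_1)\}$ is the set of reversed arcs of $\vec{H}_1$. *)

theory Defs
  imports "Graph_Theory.Graph_Theory" "HOL-Library.Numeral_Type"
begin

text \<open>
  Digraphs without parallel arcs are represented by \<^typ>\<open>'a pair_pre_digraph\<close>, whose arcs are
  ordered pairs of vertices; \<^const>\<open>with_proj\<close> embeds them into general digraphs, where the
  library notions of subdigraph and isomorphism live.
\<close>

section \<open>Ultrahomogeneous digraphs\<close>

text \<open>A copy need not be an induced subdigraph.\<close>

definition is_copy :: "'b pair_pre_digraph \<Rightarrow> 'a pair_pre_digraph \<Rightarrow> 'a pair_pre_digraph \<Rightarrow> bool"
  where "is_copy H G H0 \<longleftrightarrow>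
    subgraph (with_proj H0) (with_proj G) \<and> digraph_iso (with_proj H) (with_proj H0)"

definition pair_isomorphism ::
  "'a pair_pre_digraph \<Rightarrow> 'b pair_pre_digraph \<Rightarrow>
    ('a, 'a \<times> 'a, 'b, 'b \<times> 'b) digraph_isomorphism \<Rightarrow> bool"
  where "pair_isomorphism G H f \<longleftrightarrow>
    pre_digraph.digraph_isomorphism (with_proj G) f \<and> with_proj H = app_iso f (with_proj G)"

definition UH :: "'b pair_pre_digraph \<Rightarrow> 'a pair_pre_digraph \<Rightarrow> bool"
  where "UH H G \<longleftrightarrow>
    (\<forall>H1 H2 f. is_copy H G H1 \<longrightarrow> is_copy H G H2 \<longrightarrow> pair_isomorphism H1 H2 f \<longrightarrow>
      (\<exists>g. pair_isomorphism G G g \<and>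
        (\<forall>v \<in> pverts H1. iso_verts g v = iso_verts f v) \<and>
        (\<forall>a \<in> parcs H1. iso_arcs g a = iso_arcs f a)))"

definition UH_over :: "'b pair_pre_digraph \<Rightarrow> 'b pair_pre_digraph \<Rightarrow> 'a pair_pre_digraph \<Rightarrow> bool"
  where "UH_over H M G \<longleftrightarrow>
    subgraph (with_proj M) (with_proj H) \<and> UH M G \<and> UH H G \<and>
    (\<forall>H0 M0. is_copy H G H0 \<longrightarrow> is_copy M H0 M0 \<longrightarrow>
      (\<exists>!H1. is_copy H G H1 \<and> H1 \<noteq> H0 \<and>
        pverts H0 \<inter> pverts H1 = pverts M0 \<and>
        parcs H0 \<inter> (parcs H1)\<inverse> = parcs M0))"

section \<open>Directed cycles and paths\<close>

definition directed_cycle :: "nat \<Rightarrow> nat pair_pre_digraph"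
  where "directed_cycle n = \<lparr> pverts = {..<n}, parcs = {(i, Suc i mod n) | i. i < n} \<rparr>"

text \<open>The parameter of \<open>directed_path\<close> is the number of vertices.\<close>

definition directed_path :: "nat \<Rightarrow> nat pair_pre_digraph"
  where "directed_path n = \<lparr> pverts = {..<n}, parcs = {(i, Suc i) | i. Suc i < n} \<rparr>"

section \<open>The Coxeter graph\<close>

definition graph_to_digraph :: "'a set \<Rightarrow> 'a set set \<Rightarrow> 'a pair_pre_digraph"
  where "graph_to_digraph V E = \<lparr> pverts = V, parcs = {(x, y). {x, y} \<in> E} \<rparr>"

definition cycle_edges :: "'a list \<Rightarrow> 'a set set"
  where "cycle_edges xs = {{x, y} | x y. (x, y) \<in> set (zip xs (rotate1 xs))}"

text \<open>The type \<^typ>\<open>7\<close> has seven elements and its arithmetic is that of the integers modulo 7.\<close>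

datatype coxeter_vertex = U 7 | V 7 | T 7 | Z 7

definition coxeter_edges :: "coxeter_vertex set set"
  where "coxeter_edges =
    cycle_edges [U 1, U 2, U 3, U 4, U 5, U 6, U 0] \<union>
    cycle_edges [V 4, V 6, V 1, V 3, V 5, V 0, V 2] \<union>
    cycle_edges [T 3, T 6, T 2, T 5, T 1, T 4, T 0] \<union>
    (\<Union>x. {{Z x, U x}, {Z x, V x}, {Z x, T x}})"

definition coxeter_digraph :: "coxeter_vertex pair_pre_digraph"
  where "coxeter_digraph = graph_to_digraph UNIV coxeter_edges"

end

theory Submission
  imports Defs "HOL-Combinatorics.Transposition"
begin

text \<open>
  The automorphism group of the Coxeter graph acts transitively on 3-arcs, hence on 2-arcs, and
  every 3-arc lies on exactly one directed 7-cycle. So an isomorphism between two 7-cycles agrees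
  with an automorphism on a 3-arc, and therefore on the whole cycle. For the fastening condition
  one may assume that the cycle is a fixed one. A second cycle that runs backwards through a given
  2-arc and meets the first cycle nowhere else has to leave the 2-arc at both ends along the
  edges not used by the first cycle, and only one 7-cycle does so.
\<close>

section \<open>Embeddings and automorphisms of digraphs\<close>

text \<open>Only arcs of \<open>H\<close> are tested, and only in the forward direction, because a
  copy need not be an induced subdigraph.\<close>

definition embedding :: "'b pair_pre_digraph \<Rightarrow> 'a pair_pre_digraph \<Rightarrow> ('b \<Rightarrow> 'a) \<Rightarrow> bool"
  where "embedding H G p \<longleftrightarrow> inj_on p (pverts H) \<and> p ` pverts H \<subseteq> pverts G \<and>
    (\<forall>u v. (u, v) \<in> parcs H \<longrightarrow> (p u, p v) \<in> parcs G)"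

definition image_digraph :: "('b \<Rightarrow> 'a) \<Rightarrow> 'b pair_pre_digraph \<Rightarrow> 'a pair_pre_digraph"
  where "image_digraph p H = \<lparr> pverts = p ` pverts H, parcs = map_prod p p ` parcs H \<rparr>"

lemma image_digraph_sel [simp]:
  "pverts (image_digraph p H) = p ` pverts H" "parcs (image_digraph p H) = map_prod p p ` parcs H"
  by (simp_all add: image_digraph_def)

lemma pair_wf_digraph_image: "pair_wf_digraph H \<Longrightarrow> pair_wf_digraph (image_digraph p H)"
  by (auto simp: pair_wf_digraph_def)

text \<open>An isomorphism record carries separate maps for vertices, arcs, heads and tails. With
  arcs that are ordered pairs, all of them come from the vertex map.\<close>

definition lift_iso :: "('a \<Rightarrow> 'b) \<Rightarrow> ('a, 'a \<times> 'a, 'b, 'b \<times> 'b) digraph_isomorphism"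
  where "lift_iso p = \<lparr> iso_verts = p, iso_arcs = map_prod p p, iso_head = snd, iso_tail = fst \<rparr>"

lemma lift_iso_sel [simp]:
  "iso_verts (lift_iso p) = p" "iso_arcs (lift_iso p) = map_prod p p"
  by (simp_all add: lift_iso_def)

text \<open>The equation between \<open>with_proj H\<close> and \<open>app_iso f\<close> forces the
  projections \<open>fst\<close> and \<open>snd\<close> as tail and head of the image, so the arc
  map has no freedom on arcs of \<open>G\<close>.\<close>

lemma pair_isomorphismD:
  assumes "pair_isomorphism G H f"
  shows "inj_on (iso_verts f) (pverts G)" "H = image_digraph (iso_verts f) G"
    "\<And>a. a \<in> parcs G \<Longrightarrow> iso_arcs f a = map_prod (iso_verts f) (iso_verts f) a"
proof -
  have ends: "iso_tail f = fst" "iso_head f = snd"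
    and sel: "pverts H = iso_verts f ` pverts G" "parcs H = iso_arcs f ` parcs G"
    using assms by (auto simp: pair_isomorphism_def app_iso_def with_proj_def)
  show arcs: "iso_arcs f a = map_prod (iso_verts f) (iso_verts f) a" if "a \<in> parcs G" for a
    using assms that
    by (auto simp: pair_isomorphism_def pre_digraph.digraph_isomorphism_def ends prod_eq_iff)
  show "inj_on (iso_verts f) (pverts G)"
    using assms by (auto simp: pair_isomorphism_def pre_digraph.digraph_isomorphism_def)
  show "H = image_digraph (iso_verts f) G"
    by (rule pair_pre_digraph.equality) (use arcs in \<open>auto simp: sel\<close>)
qed

lemma pair_isomorphism_lift:
  assumes "pair_wf_digraph G" "inj_on p (pverts G)"
  shows "pair_isomorphism G (image_digraph p G) (lift_iso p)"
proof -
  have "inj_on (map_prod p p) (parcs G)"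
    using assms(1)
    by (intro inj_on_subset[OF map_prod_inj_on[OF assms(2) assms(2)]])
      (auto simp: pair_wf_digraph_def)
  then have "pre_digraph.digraph_isomorphism (with_proj G) (lift_iso p)"
    using assms by (auto simp: pre_digraph.digraph_isomorphism_def wf_digraph_wp_iff lift_iso_def)
  moreover have "with_proj (image_digraph p G) = app_iso (lift_iso p) (with_proj G)"
    by (simp add: app_iso_def with_proj_def lift_iso_def)
  ultimately show ?thesis
    by (simp add: pair_isomorphism_def)
qed

text \<open>This trades subdigraphs and isomorphism records for plain vertex maps, with which all
  later arguments work.\<close>

lemma is_copy_iff:
  assumes "pair_wf_digraph H" "pair_wf_digraph G"
  shows "is_copy H G H0 \<longleftrightarrow> (\<exists>p. embedding H G p \<and> H0 = image_digraph p H)"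
proof
  assume copy: "is_copy H G H0"
  then obtain f where f: "pair_isomorphism H H0 f"
    by (auto simp: is_copy_def digraph_iso_def pair_isomorphism_def)
  note fD = pair_isomorphismD[OF f]
  have "pverts H0 \<subseteq> pverts G" "parcs H0 \<subseteq> parcs G"
    using copy by (auto simp: is_copy_def subgraph_def)
  then have "embedding H G (iso_verts f)"
    using fD(1) unfolding embedding_def fD(2) by (auto simp: image_subset_iff)
  then show "\<exists>p. embedding H G p \<and> H0 = image_digraph p H"
    using fD(2) by blast
next
  assume "\<exists>p. embedding H G p \<and> H0 = image_digraph p H"
  then obtain p where p: "embedding H G p" "H0 = image_digraph p H"
    by blast
  have "pair_isomorphism H H0 (lift_iso p)"
    using pair_isomorphism_lift[OF assms(1)] p by (auto simp: embedding_def)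
  then have "digraph_iso (with_proj H) (with_proj H0)"
    unfolding digraph_iso_def pair_isomorphism_def by blast
  moreover have "subgraph (with_proj H0) (with_proj G)"
    using p assms pair_wf_digraph_image[OF assms(1), of p]
    by (auto simp: subgraph_def embedding_def wf_digraph_wp_iff compatible_def)
  ultimately show "is_copy H G H0"
    by (simp add: is_copy_def)
qed

lemma embedding_comp: "embedding H G p \<Longrightarrow> embedding G K q \<Longrightarrow> embedding H K (q \<circ> p)"
  unfolding embedding_def by (auto intro: comp_inj_on inj_on_subset) blast

lemma image_digraph_comp: "image_digraph q (image_digraph p H) = image_digraph (q \<circ> p) H"
  by (simp add: image_digraph_def image_comp map_prod_compose)

lemma image_digraph_cong:
  assumes "pair_wf_digraph H" "\<And>v. v \<in> pverts H \<Longrightarrow> p v = q v"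
  shows "image_digraph p H = image_digraph q H"
proof -
  have "map_prod p p a = map_prod q q a" if "a \<in> parcs H" for a
    using assms(2) pair_wf_digraph.arc_fst_in_verts[OF assms(1) that]
      pair_wf_digraph.arc_snd_in_verts[OF assms(1) that]
    by (simp add: prod_eq_iff)
  then show ?thesis
    using assms(2) by (simp add: image_digraph_def cong: image_cong)
qed

lemma image_digraph_id [simp]: "image_digraph id H = H" "image_digraph (\<lambda>x. x) H = H"
  by (simp_all add: image_digraph_def map_prod.identity[unfolded id_def] id_def)

definition automorphism :: "'a pair_pre_digraph \<Rightarrow> ('a \<Rightarrow> 'a) \<Rightarrow> bool"
  where "automorphism G g \<longleftrightarrow> inj_on g (pverts G) \<and> image_digraph g G = G"

lemma automorphism_embedding: "automorphism G g \<Longrightarrow> embedding G G g"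
  unfolding automorphism_def embedding_def
  by (metis image_digraph_sel(1,2) map_prod_imageI subset_refl)

text \<open>By finiteness, injective maps of the vertex set and of the arc set into themselves are
  onto. Hence arcs need to be checked in one direction only.\<close>

lemma automorphismI:
  assumes "finite (pverts G)" "finite (parcs G)" "pair_wf_digraph G" "embedding G G g"
  shows "automorphism G g"
proof -
  have inj: "inj_on g (pverts G)"
    using assms(4) by (simp add: embedding_def)
  have "g ` pverts G = pverts G"
    using assms by (intro endo_inj_surj) (auto simp: embedding_def)
  moreover have "map_prod g g ` parcs G = parcs G"
  proof (rule endo_inj_surj)
    show "map_prod g g ` parcs G \<subseteq> parcs G"
      using assms(4) by (auto simp: embedding_def)
    show "inj_on (map_prod g g) (parcs G)"
      using assms(3)
      by (intro inj_on_subset[OF map_prod_inj_on[OF inj inj]]) (auto simp: pair_wf_digraph_def)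
  qed (fact assms(2))
  ultimately show ?thesis
    using inj by (simp add: automorphism_def image_digraph_def)
qed

lemma automorphism_comp: "automorphism G g \<Longrightarrow> automorphism G h \<Longrightarrow> automorphism G (h \<circ> g)"
  unfolding automorphism_def
  by (metis comp_inj_on image_digraph_comp image_digraph_sel(1))

lemma automorphism_inverse:
  assumes "pair_wf_digraph G" "automorphism G g"
  obtains h where "automorphism G h" "\<And>v. v \<in> pverts G \<Longrightarrow> h (g v) = v"
    "\<And>v. v \<in> pverts G \<Longrightarrow> g (h v) = v"
proof
  let ?h = "inv_into (pverts G) g"
  have inj: "inj_on g (pverts G)" and img: "image_digraph g G = G"
    using assms(2) by (simp_all add: automorphism_def)
  then have surj: "g ` pverts G = pverts G"
    by (metis image_digraph_sel(1))
  show left: "?h (g v) = v" if "v \<in> pverts G" for v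
    using inj that by simp
  show "g (?h v) = v" if "v \<in> pverts G" for v
    using surj that by (simp add: f_inv_into_f)
  have "image_digraph ?h (image_digraph g G) = image_digraph id G"
    unfolding image_digraph_comp using left by (intro image_digraph_cong[OF assms(1)]) simp
  then have "image_digraph ?h G = G"
    by (simp only: img image_digraph_id)
  then show "automorphism G ?h"
    using inj_on_inv_into[of "pverts G" g "pverts G"] surj by (simp add: automorphism_def)
qed

text \<open>The body mirrors the formula under the unique existence quantifier of
  \<open>UH_over_def\<close>, so that it can be folded there.\<close>

definition fastened ::
  "'b pair_pre_digraph \<Rightarrow> 'a pair_pre_digraph \<Rightarrow> 'a pair_pre_digraph \<Rightarrow> 'a pair_pre_digraph \<Rightarrow>
    'a pair_pre_digraph \<Rightarrow> bool"
  where "fastened H G H0 M0 H1 \<longleftrightarrow> is_copy H G H1 \<and> H1 \<noteq> H0 \<and>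
    pverts H0 \<inter> pverts H1 = pverts M0 \<and> parcs H0 \<inter> (parcs H1)\<inverse> = parcs M0"

lemma is_copy_automorphism:
  assumes "pair_wf_digraph H" "pair_wf_digraph G" "automorphism G g" "is_copy H G H0"
  shows "is_copy H G (image_digraph g H0)"
proof -
  obtain p where "embedding H G p" "H0 = image_digraph p H"
    using assms(4) is_copy_iff[OF assms(1,2)] by blast
  then have "embedding H G (g \<circ> p)" "image_digraph g H0 = image_digraph (g \<circ> p) H"
    using automorphism_embedding[OF assms(3)] by (simp_all add: embedding_comp image_digraph_comp)
  then show ?thesis
    using is_copy_iff[OF assms(1,2)] by blast
qed

text \<open>As every element of the type is a vertex, \<open>g\<close> is injective everywhere, and
  taking images commutes with the two intersections.\<close>

lemma fastened_automorphism:
  assumes wf: "pair_wf_digraph H" "pair_wf_digraph G" and G: "pverts G = UNIV"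
    and g: "automorphism G g" and F: "fastened H G H0 M0 H1"
  shows "fastened H G (image_digraph g H0) (image_digraph g M0) (image_digraph g H1)"
proof -
  have inj: "inj g" "inj (map_prod g g)"
    using g G by (simp_all add: automorphism_def prod.inj_map)
  obtain h where h: "\<And>v. h (g v) = v"
    using automorphism_inverse[OF wf(2) g] G by (metis UNIV_I)
  \<comment> \<open>Undoing \<open>g\<close> shows that distinct digraphs keep distinct
    images.\<close>
  have "image_digraph h (image_digraph g X) = X" for X
    by (simp add: image_digraph_comp comp_def h)
  then have "image_digraph g H1 \<noteq> image_digraph g H0"
    using F unfolding fastened_def by metis
  moreover have "is_copy H G (image_digraph g H1)"
    using F is_copy_automorphism[OF wf g] by (simp add: fastened_def)
  moreover have "(map_prod g g ` parcs H1)\<inverse> = map_prod g g ` (parcs H1)\<inverse>"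
    by force
  ultimately show ?thesis
    using F inj by (simp add: fastened_def flip: image_Int)
qed

text \<open>Applying \<open>g\<close> and its inverse gives mutually inverse maps between the
  solutions for \<open>H0\<close>, \<open>M0\<close> and those for their images.\<close>

lemma unique_fastened_automorphism:
  assumes wf: "pair_wf_digraph H" "pair_wf_digraph G" and G: "pverts G = UNIV"
    and g: "automorphism G g" and ex1: "\<exists>!H1. fastened H G H0 M0 H1"
  shows "\<exists>!H1. fastened H G (image_digraph g H0) (image_digraph g M0) H1"
proof -
  obtain h where h: "automorphism G h" "\<And>v. h (g v) = v" "\<And>v. g (h v) = v"
    using automorphism_inverse[OF wf(2) g] G by (metis UNIV_I)
  have hg: "image_digraph h (image_digraph g X) = X" "image_digraph g (image_digraph h X) = X" for X
    by (simp_all add: image_digraph_comp comp_def h)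
  show ?thesis
    using ex1 fastened_automorphism[OF wf G] g h(1) hg by metis
qed

text \<open>If \<open>H1\<close> is the image of \<open>p\<close>, then an isomorphism
  \<open>f\<close> from \<open>H1\<close> to another copy yields a second embedding,
  \<open>f\<close> after \<open>p\<close>. An automorphism that takes the first embedding to the
  second extends \<open>f\<close>.\<close>

lemma UH_I:
  assumes wf: "pair_wf_digraph H" "pair_wf_digraph G"
    and ext: "\<And>p q. embedding H G p \<Longrightarrow> embedding H G q \<Longrightarrow>
      \<exists>g. automorphism G g \<and> (\<forall>v \<in> pverts H. g (p v) = q v)"
  shows "UH H G"
  unfolding UH_def
proof (intro allI impI)
  fix H1 H2 f
  assume copies: "is_copy H G H1" "is_copy H G H2" and f: "pair_isomorphism H1 H2 f"
  obtain p where p: "embedding H G p" "H1 = image_digraph p H"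
    using copies(1) is_copy_iff[OF wf] by blast
  note fD = pair_isomorphismD[OF f]
  have "pverts H2 \<subseteq> pverts G" "parcs H2 \<subseteq> parcs G"
    using copies(2) by (auto simp: is_copy_def subgraph_def)
  moreover have "inj_on (iso_verts f \<circ> p) (pverts H)"
    using p fD(1) by (auto simp: embedding_def intro: comp_inj_on)
  ultimately have "embedding H G (iso_verts f \<circ> p)"
    unfolding embedding_def fD(2) p(2) by (auto simp: image_subset_iff)
  from ext[OF p(1) this]
  obtain g where g: "automorphism G g" "\<forall>v \<in> pverts H. g (p v) = iso_verts f (p v)"
    by auto
  have eq: "g v = iso_verts f v" if "v \<in> pverts H1" for v
    using that g p by auto
  have "pair_isomorphism G G (lift_iso g)"
    using pair_isomorphism_lift[OF wf(2), of g] g(1) by (simp add: automorphism_def)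
  moreover have "iso_arcs (lift_iso g) a = iso_arcs f a" if "a \<in> parcs H1" for a
  proof -
    have "fst a \<in> pverts H1" "snd a \<in> pverts H1"
      using that p pair_wf_digraph.arc_fst_in_verts[OF pair_wf_digraph_image[OF wf(1)]]
        pair_wf_digraph.arc_snd_in_verts[OF pair_wf_digraph_image[OF wf(1)]]
      by blast+
    then show ?thesis
      using fD(3)[OF that] eq by (simp add: prod_eq_iff)
  qed
  ultimately show "\<exists>g. pair_isomorphism G G g \<and>
      (\<forall>v \<in> pverts H1. iso_verts g v = iso_verts f v) \<and>
      (\<forall>a \<in> parcs H1. iso_arcs g a = iso_arcs f a)"
    using eq by (intro exI[of _ "lift_iso g"]) simp
qed

section \<open>Adjacency in the Coxeter graph\<close>

abbreviation adj :: "coxeter_vertex \<Rightarrow> coxeter_vertex \<Rightarrow> bool"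
  where "adj x y \<equiv> (x, y) \<in> parcs coxeter_digraph"

lemma UNIV_7: "(UNIV :: 7 set) = {0, 1, 2, 3, 4, 5, 6}"
proof -
  have "card {0, 1, 2, 3, 4, 5, 6 :: 7} = CARD(7)" by simp
  then show ?thesis by (metis card_subset_eq finite subset_UNIV)
qed

lemma forall_7: "(\<forall>x::7. P x) \<longleftrightarrow> P 0 \<and> P 1 \<and> P 2 \<and> P 3 \<and> P 4 \<and> P 5 \<and> P 6"
  using UNIV_7 by (metis UNIV_I insert_iff singletonD)

lemma mem_cycle_edges: "{a, b} \<in> cycle_edges xs \<longleftrightarrow>
   (a, b) \<in> set (zip xs (rotate1 xs)) \<or> (b, a) \<in> set (zip xs (rotate1 xs))"
  by (auto simp: cycle_edges_def doubleton_eq_iff)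

lemma numeral_7: "(7::7) = 0" "(8::7) = 1" "(9::7) = 2" "(10::7) = 3" "(11::7) = 4" "(12::7) = 5"
  "(-1::7) = 6" "(-2::7) = 5" "(-3::7) = 4" "(-4::7) = 3" "(-5::7) = 2" "(-6::7) = 1"
  by simp_all

text \<open>The listed orders advance by the constant steps 1, 2 and 3 modulo 7, which makes the
  cyclic symmetry visible.\<close>

lemma cycle_steps:
  "set (zip [U 1, U 2, U 3, U 4, U 5, U 6, U 0] (rotate1 [U 1, U 2, U 3, U 4, U 5, U 6, U 0])) =
    range (\<lambda>x. (U x, U (x + 1)))"
  "set (zip [V 4, V 6, V 1, V 3, V 5, V 0, V 2] (rotate1 [V 4, V 6, V 1, V 3, V 5, V 0, V 2])) =
    range (\<lambda>x. (V x, V (x + 2)))"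
  "set (zip [T 3, T 6, T 2, T 5, T 1, T 4, T 0] (rotate1 [T 3, T 6, T 2, T 5, T 1, T 4, T 0])) =
    range (\<lambda>x. (T x, T (x + 3)))"
  by (simp_all add: UNIV_7 numeral_7 insert_commute)

lemma adj_unfold: "adj a b \<longleftrightarrow>
   (\<exists>x. (a, b) = (U x, U (x + 1)) \<or> (b, a) = (U x, U (x + 1)) \<or>
     (a, b) = (V x, V (x + 2)) \<or> (b, a) = (V x, V (x + 2)) \<or>
     (a, b) = (T x, T (x + 3)) \<or> (b, a) = (T x, T (x + 3)) \<or>
     (\<exists>W\<in>{U, V, T}. (a, b) = (Z x, W x) \<or> (b, a) = (Z x, W x)))"
  unfolding coxeter_digraph_def graph_to_digraph_def coxeter_edges_def
    Un_iff mem_Collect_eq pair_pre_digraph.simps split_conv mem_cycle_edges cycle_steps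
  by (cases a; cases b; auto simp: doubleton_eq_iff)

text \<open>These neighbour lists drive all later case analyses.\<close>

lemma adj_iff:
  "adj (U x) w \<longleftrightarrow> w \<in> {U (x + 1), U (x - 1), Z x}"
  "adj (V x) w \<longleftrightarrow> w \<in> {V (x + 2), V (x - 2), Z x}"
  "adj (T x) w \<longleftrightarrow> w \<in> {T (x + 3), T (x - 3), Z x}"
  "adj (Z x) w \<longleftrightarrow> w \<in> {U x, V x, T x}"
  \<comment> \<open>An edge traversed backwards gives \<open>x = y + 1\<close>, and
    \<open>eq_diff_eq\<close> brings the listed \<open>y = x - 1\<close> to that form.\<close>
  unfolding adj_unfold
  by (cases w; auto simp: eq_diff_eq)+

section \<open>Transitivity on 3-arcs\<close>

lemma adj_sym: "adj x y \<Longrightarrow> adj y x"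
  by (simp add: coxeter_digraph_def graph_to_digraph_def insert_commute)

lemma pverts_coxeter [simp]: "pverts coxeter_digraph = UNIV"
  by (simp add: coxeter_digraph_def graph_to_digraph_def)

lemma coxeter_wf: "pair_wf_digraph coxeter_digraph"
  by (simp add: pair_wf_digraph_def)

lemma finite_coxeter_vertex: "finite (UNIV :: coxeter_vertex set)"
proof (rule finite_subset)
  show "UNIV \<subseteq> range U \<union> range V \<union> range T \<union> range Z"
  proof
    fix v show "v \<in> range U \<union> range V \<union> range T \<union> range Z"
      by (cases v) auto
  qed
qed simp

lemma coxeter_automorphismI:
  assumes "inj g" "\<And>x y. adj x y \<Longrightarrow> adj (g x) (g y)"
  shows "automorphism coxeter_digraph g"
proof (rule automorphismI)
  show "finite (parcs coxeter_digraph)"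
    using finite_coxeter_vertex
    by (intro finite_subset[OF subset_UNIV finite_Prod_UNIV])
qed (use assms in \<open>auto simp: finite_coxeter_vertex coxeter_wf embedding_def\<close>)

section \<open>Explicit automorphisms of the Coxeter graph\<close>

primrec shift :: "7 \<Rightarrow> coxeter_vertex \<Rightarrow> coxeter_vertex" where
  "shift c (U x) = U (x + c)"
| "shift c (V x) = V (x + c)"
| "shift c (T x) = T (x + c)"
| "shift c (Z x) = Z (x + c)"

text \<open>Multiplication by 2 turns the steps 1, 2, 3 into 2, 4, 6, that is 2, -3, -1 modulo 7.
  Hence the \<open>U\<close>, \<open>V\<close> and \<open>T\<close> cycles are permuted
  cyclically.\<close>

primrec double :: "coxeter_vertex \<Rightarrow> coxeter_vertex" where
  "double (U x) = V (2 * x)"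
| "double (V x) = T (2 * x)"
| "double (T x) = U (2 * x)"
| "double (Z x) = Z (2 * x)"

primrec negate :: "coxeter_vertex \<Rightarrow> coxeter_vertex" where
  "negate (U x) = U (- x)"
| "negate (V x) = V (- x)"
| "negate (T x) = T (- x)"
| "negate (Z x) = Z (- x)"

text \<open>
  The shifts, \<open>double\<close> and \<open>negate\<close> all permute the vertices \<open>Z x\<close> among themselves. The
  involution below is the unique automorphism fixing the 2-arc \<open>Z 0, U 0, U 1\<close> and exchanging
  the two ways to prolong it.
\<close>

definition flip :: "coxeter_vertex \<Rightarrow> coxeter_vertex"
  where "flip =
    transpose (U 2) (Z 1) \<circ> transpose (T 0) (V 0) \<circ> transpose (U 3) (V 1) \<circ>
    transpose (T 3) (V 5) \<circ> transpose (T 4) (V 2) \<circ> transpose (U 5) (Z 6) \<circ>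
    transpose (T 1) (Z 2) \<circ> transpose (U 4) (V 6) \<circ> transpose (T 2) (T 5) \<circ>
    transpose (V 4) (Z 4) \<circ> transpose (V 3) (Z 3) \<circ> transpose (T 6) (Z 5)"

lemma shift_automorphism: "automorphism coxeter_digraph (shift c)"
proof (rule coxeter_automorphismI)
  show "inj (shift c)"
  proof (rule inj_on_inverseI)
    show "shift (- c) (shift c x) = x" for x
      by (cases x) simp_all
  qed
  show "adj (shift c x) (shift c y)" if "adj x y" for x y
    using that by (cases x) (auto simp: adj_iff algebra_simps)
qed

lemma double_automorphism: "automorphism coxeter_digraph double"
proof (rule coxeter_automorphismI)
  have "7 * x = 0" for x :: 7
    by (metis mult_zero_left numeral_7(1))
  \<comment> \<open>This is 8 = 1 modulo 7. It makes the sixth iterate of \<open>double\<close> the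
    identity, so that the fifth iterate is a left inverse.\<close>
  then have eight: "2 * (2 * (2 * x)) = x" for x :: 7
    by (simp flip: mult.assoc)
  have "double (double (double (double (double (double x))))) = x" for x
    by (cases x) (simp_all only: double.simps eight)
  then show "inj double"
    by (rule inj_on_inverseI)
  have six: "2 * (x + 3) = 2 * x - 1" "2 * (x - 3) = 2 * x + 1" for x :: 7
    by (simp_all add: algebra_simps)
  show "adj (double x) (double y)" if "adj x y" for x y
    using that by (cases x) (auto simp: adj_iff six algebra_simps)
qed

lemma negate_automorphism: "automorphism coxeter_digraph negate"
proof (rule coxeter_automorphismI)
  have "negate (negate x) = x" for x
    by (cases x) simp_all
  then show "inj negate"
    by (rule inj_on_inverseI)
  show "adj (negate x) (negate y)" if "adj x y" for x y
    using that by (cases x) (auto simp: adj_iff)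
qed

text \<open>The twelve transpositions are disjoint. The fixed vertices are \<open>U 0\<close> and
  its three neighbours, and at each of these neighbours the two remaining neighbours are
  exchanged.\<close>

lemma flip_simps:
  "flip (U 0) = U 0" "flip (U 1) = U 1" "flip (U 2) = Z 1" "flip (U 3) = V 1"
  "flip (U 4) = V 6" "flip (U 5) = Z 6" "flip (U 6) = U 6"
  "flip (V 0) = T 0" "flip (V 1) = U 3" "flip (V 2) = T 4" "flip (V 3) = Z 3"
  "flip (V 4) = Z 4" "flip (V 5) = T 3" "flip (V 6) = U 4"
  "flip (T 0) = V 0" "flip (T 1) = Z 2" "flip (T 2) = T 5" "flip (T 3) = V 5"
  "flip (T 4) = V 2" "flip (T 5) = T 2" "flip (T 6) = Z 5"
  "flip (Z 0) = Z 0" "flip (Z 1) = U 2" "flip (Z 2) = T 1" "flip (Z 3) = V 3"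
  "flip (Z 4) = V 4" "flip (Z 5) = T 6" "flip (Z 6) = U 5"
  by (simp_all add: flip_def transpose_def)

lemma flip_automorphism: "automorphism coxeter_digraph flip"
proof (rule coxeter_automorphismI)
  show "inj flip"
    unfolding flip_def by (intro inj_compose inj_on_transpose)
  \<comment> \<open>Each of the 42 edges is checked in one orientation; \<open>adj_sym\<close>
    supplies the other.\<close>
  have "\<forall>x. adj (flip (U x)) (flip (U (x + 1))) \<and> adj (flip (V x)) (flip (V (x + 2))) \<and>
      adj (flip (T x)) (flip (T (x + 3))) \<and> (\<forall>W\<in>{U, V, T}. adj (flip (Z x)) (flip (W x)))"
    by (simp add: forall_7 numeral_7 flip_simps adj_iff)
  then show "adj (flip x) (flip y)" if "adj x y" for x y
    using that[unfolded adj_unfold] by (auto intro: adj_sym)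
qed

section \<open>Transitivity on vertices, arcs, 2-arcs and 3-arcs\<close>

lemma automorphism_adj: "automorphism coxeter_digraph g \<Longrightarrow> adj x y \<Longrightarrow> adj (g x) (g y)"
  using automorphism_embedding[of coxeter_digraph g] by (simp add: embedding_def)

lemma automorphism_inj: "automorphism coxeter_digraph g \<Longrightarrow> inj g"
  by (simp add: automorphism_def)

lemma automorphism_to_Z0: "\<exists>g. automorphism coxeter_digraph g \<and> g v = Z 0"
proof -
  note auts = shift_automorphism double_automorphism flip_automorphism
  have Z: "\<exists>g. automorphism coxeter_digraph g \<and> g (Z x) = Z 0" for x
    by (intro exI[of _ "shift (- x)"]) (simp add: auts)
  have step: "\<exists>g. automorphism coxeter_digraph g \<and> g v = Z 0"
    if "automorphism coxeter_digraph h" "\<exists>g. automorphism coxeter_digraph g \<and> g (h v) = Z 0" for h v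
    using that automorphism_comp[of coxeter_digraph h] by (metis comp_apply)
  have U: "\<exists>g. automorphism coxeter_digraph g \<and> g (U x) = Z 0" for x
    \<comment> \<open>The shift brings \<open>U x\<close> to \<open>U 2\<close>, which
      \<open>flip\<close> sends to \<open>Z 1\<close>. The \<open>T\<close> and then the
      \<open>V\<close> vertices reduce to this case by \<open>double\<close>.\<close>
    by (rule step[of "flip \<circ> shift (2 - x)"]) (simp_all add: auts automorphism_comp flip_simps Z)
  have T: "\<exists>g. automorphism coxeter_digraph g \<and> g (T x) = Z 0" for x
    by (rule step[of double]) (simp_all add: auts U)
  have V: "\<exists>g. automorphism coxeter_digraph g \<and> g (V x) = Z 0" for x
    by (rule step[of double]) (simp_all add: auts T)
  show ?thesis
    by (cases v) (simp_all add: U V T Z)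
qed

text \<open>\<open>double\<close> fixes \<open>Z 0\<close> and rotates its neighbours
  \<open>U 0\<close>, \<open>V 0\<close>, \<open>T 0\<close>.\<close>

lemma automorphism_to_arc:
  assumes "adj a b"
  shows "\<exists>g. automorphism coxeter_digraph g \<and> g a = Z 0 \<and> g b = U 0"
proof -
  obtain g where g: "automorphism coxeter_digraph g" "g a = Z 0"
    using automorphism_to_Z0 by blast
  have "adj (Z 0) (g b)"
    using automorphism_adj[OF g(1) assms] g(2) by simp
  then consider "g b = U 0" | "g b = V 0" | "g b = T 0"
    by (auto simp: adj_iff)
  then show ?thesis
  proof cases
    case 1
    then show ?thesis using g by blast
  next
    case 2
    with g show ?thesis
      by (intro exI[of _ "double \<circ> double \<circ> g"]) (simp add: automorphism_comp double_automorphism)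
  next
    case 3
    with g show ?thesis
      by (intro exI[of _ "double \<circ> g"]) (simp add: automorphism_comp double_automorphism)
  qed
qed

text \<open>\<open>negate\<close> fixes \<open>Z 0\<close> and \<open>U 0\<close> and exchanges
  \<open>U 1\<close> with \<open>U (- 1)\<close>, the two ways to go on.\<close>

lemma automorphism_to_2arc:
  assumes "adj a b" "adj b c" "a \<noteq> c"
  shows "\<exists>g. automorphism coxeter_digraph g \<and> g a = Z 0 \<and> g b = U 0 \<and> g c = U 1"
proof -
  obtain g where g: "automorphism coxeter_digraph g" "g a = Z 0" "g b = U 0"
    using automorphism_to_arc[OF assms(1)] by blast
  have "adj (U 0) (g c)" "g a \<noteq> g c"
    using automorphism_adj[OF g(1) assms(2)] assms(3) automorphism_inj[OF g(1)] g(3)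
    by (auto dest: injD)
  then consider "g c = U 1" | "g c = U (- 1)"
    using g by (auto simp: adj_iff)
  then show ?thesis
  proof cases
    case 1
    then show ?thesis using g by blast
  next
    case 2
    with g show ?thesis
      by (intro exI[of _ "negate \<circ> g"]) (simp add: automorphism_comp negate_automorphism)
  qed
qed

text \<open>The last choice, between \<open>U 2\<close> and \<open>Z 1\<close>, is settled by
  \<open>flip\<close>, which fixes \<open>Z 0\<close>, \<open>U 0\<close> and
  \<open>U 1\<close>.\<close>

lemma automorphism_to_3arc:
  assumes "adj a b" "adj b c" "adj c d" "a \<noteq> c" "b \<noteq> d"
  shows "\<exists>g. automorphism coxeter_digraph g \<and> g a = Z 0 \<and> g b = U 0 \<and> g c = U 1 \<and> g d = U 2"
proof -
  obtain g where g: "automorphism coxeter_digraph g" "g a = Z 0" "g b = U 0" "g c = U 1"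
    using automorphism_to_2arc[OF assms(1,2,4)] by blast
  have "adj (U 1) (g d)" "g b \<noteq> g d"
    using automorphism_adj[OF g(1) assms(3)] assms(5) automorphism_inj[OF g(1)] g(4)
    by (auto dest: injD)
  then consider "g d = U 2" | "g d = Z 1"
    using g by (auto simp: adj_iff)
  then show ?thesis
  proof cases
    case 1
    then show ?thesis using g by blast
  next
    case 2
    with g show ?thesis
      by (intro exI[of _ "flip \<circ> g"]) (simp add: automorphism_comp flip_automorphism flip_simps)
  qed
qed

section \<open>The 7-cycles of the Coxeter graph\<close>

lemma directed_cycle_wf: "n > 0 \<Longrightarrow> pair_wf_digraph (directed_cycle n)"
  by (auto simp: directed_cycle_def pair_wf_digraph_def)

lemma directed_path_wf: "pair_wf_digraph (directed_path n)"
  by (auto simp: directed_path_def pair_wf_digraph_def)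

lemma lessThan_7: "{..<7::nat} = {0, 1, 2, 3, 4, 5, 6}"
  by auto

lemma directed_cycle_7:
  "directed_cycle 7 = \<lparr> pverts = {0, 1, 2, 3, 4, 5, 6},
    parcs = {(0, 1), (1, 2), (2, 3), (3, 4), (4, 5), (5, 6), (6, 0)} \<rparr>"
proof -
  have "{(i, Suc i mod 7) | i. i < 7} = (\<lambda>i. (i, Suc i mod 7)) ` {..<7::nat}"
    by auto
  then show ?thesis
    unfolding directed_cycle_def lessThan_7 by (simp add: numeral_2_eq_2)
qed

lemma directed_path_3: "directed_path 3 = \<lparr> pverts = {0, 1, 2}, parcs = {(0, 1), (1, 2)} \<rparr>"
proof -
  have "{(i, Suc i) | i. Suc i < 3} = (\<lambda>i. (i, Suc i)) ` {..<2::nat}"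
    by auto
  moreover have "{..<2::nat} = {0, 1}" "{..<3::nat} = {0, 1, 2}"
    by auto
  ultimately show ?thesis
    unfolding directed_path_def by (simp add: numeral_2_eq_2)
qed

text \<open>A copy of the cycle has no distinguished first vertex; rotations allow its indexing to
  start anywhere.\<close>

lemma directed_cycle_rotation:
  assumes "n > 0"
  shows "automorphism (directed_cycle n) (\<lambda>k. (i + k) mod n)"
proof (rule automorphismI[OF _ _ directed_cycle_wf[OF assms]])
  have le: "l \<le> k" if "l < n" "(i + k) mod n = (i + l) mod n" for k l
  proof (rule ccontr)
    assume "\<not> l \<le> k"
    \<comment> \<open>The difference is positive and less than \<open>n\<close>, so it cannot be a
      multiple of \<open>n\<close>.\<close>
    then have "n dvd l - k"
      using that(2) mod_eq_dvd_iff_nat[of "i + k" "i + l" n] by simp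
    then show False
      using \<open>\<not> l \<le> k\<close> that(1) by (auto dest: dvd_imp_le)
  qed
  then have "inj_on (\<lambda>k. (i + k) mod n) {..<n}"
    by (intro inj_onI antisym) simp_all
  moreover have "Suc ((i + k) mod n) mod n = (i + Suc k mod n) mod n" for k
    by (simp add: mod_simps)
  ultimately show "embedding (directed_cycle n) (directed_cycle n) (\<lambda>k. (i + k) mod n)"
    using assms by (auto simp: embedding_def directed_cycle_def)
qed (simp_all add: directed_cycle_def)

lemma embedding_cycle_7:
  "embedding (directed_cycle 7) coxeter_digraph c \<longleftrightarrow>
    distinct [c 0, c 1, c 2, c 3, c 4, c 5, c 6] \<and>
    adj (c 0) (c 1) \<and> adj (c 1) (c 2) \<and> adj (c 2) (c 3) \<and> adj (c 3) (c 4) \<and>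
    adj (c 4) (c 5) \<and> adj (c 5) (c 6) \<and> adj (c 6) (c 0)"
proof -
  have "inj_on c {0, 1, 2, 3, 4, 5, 6} \<longleftrightarrow> distinct [c 0, c 1, c 2, c 3, c 4, c 5, c 6]"
    using distinct_map[of c "[0, 1, 2, 3, 4, 5, 6]"] by simp
  then show ?thesis
    by (simp add: embedding_def directed_cycle_7 all_conj_distrib imp_disjL
        del: distinct.simps inj_on_insert)
qed

lemma embedding_path_3:
  "embedding (directed_path 3) coxeter_digraph c \<longleftrightarrow>
    distinct [c 0, c 1, c 2] \<and> adj (c 0) (c 1) \<and> adj (c 1) (c 2)"
  by (auto simp: embedding_def directed_path_3)

text \<open>Its indices 0, 1, 2 carry the reference 2-arc, so the same map also embeds
  \<open>directed_path 3\<close>.\<close>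

definition base_cycle :: "nat \<Rightarrow> coxeter_vertex"
  where "base_cycle i = [Z 0, U 0, U 1, U 2, Z 2, V 2, V 0] ! i"

text \<open>It runs backwards through the reference 2-arc and then closes up through vertices off
  the base cycle.\<close>

definition second_cycle :: "nat \<Rightarrow> coxeter_vertex"
  where "second_cycle i = [U 1, U 0, Z 0, T 0, T 4, T 1, Z 1] ! i"

lemma second_cycle_embedding: "embedding (directed_cycle 7) coxeter_digraph second_cycle"
  by (simp add: embedding_cycle_7 second_cycle_def adj_iff)

lemma cycle_7_eqI:
  assumes "c 0 = d 0" "c 1 = d 1" "c 2 = d 2" "c 3 = d 3" "c 4 = d 4" "c 5 = d 5" "c 6 = d 6"
  shows "\<forall>v \<in> pverts (directed_cycle 7). c v = d v"
  using assms by (simp add: directed_cycle_7)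

text \<open>The vertex \<open>c 5\<close> is a common neighbour of \<open>c 4\<close> and
  \<open>c 6\<close>. Among the candidates \<open>U 3\<close>, \<open>Z 2\<close> for
  \<open>c 4\<close> and \<open>V 0\<close>, \<open>T 0\<close> for \<open>c 6\<close>, only
  \<open>Z 2\<close> and \<open>V 0\<close> have one, namely \<open>V 2\<close>.\<close>

lemma base_cycle_unique:
  assumes "embedding (directed_cycle 7) coxeter_digraph c"
    "c 0 = Z 0" "c 1 = U 0" "c 2 = U 1" "c 3 = U 2"
  shows "\<forall>v \<in> pverts (directed_cycle 7). c v = base_cycle v"
proof -
  have distinct: "distinct [c 0, c 1, c 2, c 3, c 4, c 5, c 6]"
    and "adj (U 2) (c 4)" "adj (c 4) (c 5)" "adj (Z 0) (c 6)" "adj (c 6) (c 5)"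
    using assms by (auto simp: embedding_cycle_7 adj_sym)
  then have "c 4 \<in> {U 3, Z 2}" "c 6 \<in> {V 0, T 0}"
    using assms(2-5) by (auto simp: adj_iff)
  then have "c 4 = Z 2 \<and> c 5 = V 2 \<and> c 6 = V 0"
    using \<open>adj (c 4) (c 5)\<close> \<open>adj (c 6) (c 5)\<close> distinct assms(2-5)
    by (auto simp: adj_iff numeral_7)
  then show ?thesis
    using assms(2-5) by (intro cycle_7_eqI) (simp_all add: base_cycle_def)
qed

text \<open>An automorphism normalises the first four vertices, and the other three are then
  forced.\<close>

lemma automorphism_to_base_cycle:
  assumes "embedding (directed_cycle 7) coxeter_digraph c"
  obtains g where "automorphism coxeter_digraph g"
    "\<And>v. v \<in> pverts (directed_cycle 7) \<Longrightarrow> g (c v) = base_cycle v"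
proof -
  obtain g where g: "automorphism coxeter_digraph g"
    "g (c 0) = Z 0" "g (c 1) = U 0" "g (c 2) = U 1" "g (c 3) = U 2"
    using assms automorphism_to_3arc[of "c 0" "c 1" "c 2" "c 3"] by (auto simp: embedding_cycle_7)
  have "embedding (directed_cycle 7) coxeter_digraph (g \<circ> c)"
    using embedding_comp[OF assms automorphism_embedding[OF g(1)]] .
  then show ?thesis
    using base_cycle_unique[of "g \<circ> c"] g that by simp
qed

section \<open>Ultrahomogeneity for 7-cycles and 2-arcs\<close>

lemma UH_cycle: "UH (directed_cycle 7) coxeter_digraph"
proof (rule UH_I[OF directed_cycle_wf coxeter_wf])
  fix p q :: "nat \<Rightarrow> coxeter_vertex"
  assume emb: "embedding (directed_cycle 7) coxeter_digraph p"
    "embedding (directed_cycle 7) coxeter_digraph q"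
  obtain g where g: "automorphism coxeter_digraph g"
    "\<And>v. v \<in> pverts (directed_cycle 7) \<Longrightarrow> g (p v) = base_cycle v"
    using automorphism_to_base_cycle[OF emb(1)] by blast
  obtain h where h: "automorphism coxeter_digraph h"
    "\<And>v. v \<in> pverts (directed_cycle 7) \<Longrightarrow> h (q v) = base_cycle v"
    using automorphism_to_base_cycle[OF emb(2)] by blast
  \<comment> \<open>Both embeddings are compared with the base cycle: \<open>g\<close> leads from
    \<open>p\<close> to it, and the inverse \<open>k\<close> of \<open>h\<close> leads from it to
    \<open>q\<close>.\<close>
  obtain k where k: "automorphism coxeter_digraph k" "\<And>v. k (h v) = v"
    using automorphism_inverse[OF coxeter_wf h(1)] by (metis UNIV_I pverts_coxeter)
  show "\<exists>g. automorphism coxeter_digraph g \<and> (\<forall>v \<in> pverts (directed_cycle 7). g (p v) = q v)"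
  proof (intro exI[of _ "k \<circ> g"] conjI ballI)
    show "automorphism coxeter_digraph (k \<circ> g)"
      using g(1) k(1) by (rule automorphism_comp)
    show "(k \<circ> g) (p v) = q v" if "v \<in> pverts (directed_cycle 7)" for v
      using g(2)[OF that] h(2)[OF that] k(2)[of "q v"] by simp
  qed
qed simp

lemma UH_path: "UH (directed_path 3) coxeter_digraph"
proof (rule UH_I[OF directed_path_wf coxeter_wf])
  fix p q :: "nat \<Rightarrow> coxeter_vertex"
  assume emb: "embedding (directed_path 3) coxeter_digraph p"
    "embedding (directed_path 3) coxeter_digraph q"
  obtain g where g: "automorphism coxeter_digraph g" "g (p 0) = Z 0" "g (p 1) = U 0" "g (p 2) = U 1"
    using emb(1) automorphism_to_2arc[of "p 0" "p 1" "p 2"] by (auto simp: embedding_path_3)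
  obtain h where h: "automorphism coxeter_digraph h" "h (q 0) = Z 0" "h (q 1) = U 0" "h (q 2) = U 1"
    using emb(2) automorphism_to_2arc[of "q 0" "q 1" "q 2"] by (auto simp: embedding_path_3)
  obtain k where k: "automorphism coxeter_digraph k" "\<And>v. k (h v) = v"
    using automorphism_inverse[OF coxeter_wf h(1)] by (metis UNIV_I pverts_coxeter)
  have "automorphism coxeter_digraph (k \<circ> g)"
    using g(1) k(1) by (rule automorphism_comp)
  moreover have "\<forall>v \<in> pverts (directed_path 3). (k \<circ> g) (p v) = q v"
    using g h k(2)[of "q 0"] k(2)[of "q 1"] k(2)[of "q 2"] by (simp add: directed_path_3)
  ultimately show
    "\<exists>g. automorphism coxeter_digraph g \<and> (\<forall>v \<in> pverts (directed_path 3). g (p v) = q v)"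
    by blast
qed

section \<open>The fastening condition\<close>

lemma cycle_with_2arc:
  assumes "is_copy (directed_cycle 7) coxeter_digraph H0"
    and arcs: "(x, y) \<in> parcs H0" "(y, z) \<in> parcs H0"
  obtains c where "embedding (directed_cycle 7) coxeter_digraph c"
    "H0 = image_digraph c (directed_cycle 7)" "c 0 = x" "c 1 = y" "c 2 = z"
proof -
  obtain c where c: "embedding (directed_cycle 7) coxeter_digraph c"
    "H0 = image_digraph c (directed_cycle 7)"
    using assms(1) is_copy_iff[OF directed_cycle_wf coxeter_wf] by auto
  obtain i where i: "i < 7" "x = c i" "y = c (Suc i mod 7)"
    using arcs(1) c(2) by (auto simp: directed_cycle_def)
  obtain j where j: "j < 7" "y = c j" "z = c (Suc j mod 7)"
    using arcs(2) c(2) by (auto simp: directed_cycle_def)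
  have "inj_on c {..<7}"
    using c(1) by (simp add: embedding_def directed_cycle_def)
  \<comment> \<open>The middle vertex \<open>y\<close> occurs under both indices, and
    \<open>c\<close> is injective.\<close>
  then have "j = Suc i mod 7"
    using i(3) j(1,2) by (auto dest: inj_onD)
  then have z: "z = c ((i + 2) mod 7)"
    using j(3) by (simp add: mod_simps)
  define r where "r k = (i + k) mod 7" for k
  have r: "automorphism (directed_cycle 7) r"
    unfolding r_def by (rule directed_cycle_rotation) simp
  show ?thesis
  proof (rule that[of "c \<circ> r"])
    show "embedding (directed_cycle 7) coxeter_digraph (c \<circ> r)"
      using embedding_comp[OF automorphism_embedding[OF r] c(1)] .
    \<comment> \<open>Precomposing with a rotation changes the indexing but not the image.\<close>
    show "H0 = image_digraph (c \<circ> r) (directed_cycle 7)"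
      using r c(2) by (simp add: automorphism_def flip: image_digraph_comp)
  qed (use i z in \<open>simp_all add: r_def\<close>)
qed

lemma base_fastened:
  "\<exists>!H1. fastened (directed_cycle 7) coxeter_digraph (image_digraph base_cycle (directed_cycle 7))
    (image_digraph base_cycle (directed_path 3)) H1"
    (is "\<exists>!H1. fastened _ _ ?H0 ?M0 H1")
proof (rule ex1I)
  let ?H1 = "image_digraph second_cycle (directed_cycle 7)"
  have verts: "pverts ?H0 = {Z 0, U 0, U 1, U 2, Z 2, V 2, V 0}"
    by (simp add: directed_cycle_7 base_cycle_def)
  have path: "pverts ?M0 = {Z 0, U 0, U 1}" "parcs ?M0 = {(Z 0, U 0), (U 0, U 1)}"
    by (simp_all add: directed_path_3 base_cycle_def)
  have inter: "pverts ?H0 \<inter> pverts ?H1 = pverts ?M0"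
    by (simp add: directed_cycle_7 directed_path_3 base_cycle_def second_cycle_def Int_insert_left
        insert_commute)
  moreover have "parcs ?H0 \<inter> (parcs ?H1)\<inverse> = parcs ?M0"
    by (simp add: directed_cycle_7 directed_path_3 base_cycle_def second_cycle_def Int_insert_left)
  moreover have "is_copy (directed_cycle 7) coxeter_digraph ?H1"
    using second_cycle_embedding is_copy_iff[OF directed_cycle_wf coxeter_wf] by auto
  moreover have "?H1 \<noteq> ?H0"
  proof
    assume "?H1 = ?H0"
    then have "pverts ?H0 = pverts ?M0"
      using inter by simp
    moreover have "U 2 \<in> pverts ?H0" "U 2 \<notin> pverts ?M0"
      unfolding verts path by simp_all
    ultimately show False
      by blast
  qed
  ultimately show "fastened (directed_cycle 7) coxeter_digraph ?H0 ?M0 ?H1"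
    by (simp add: fastened_def)
next
  fix H1
  assume F: "fastened (directed_cycle 7) coxeter_digraph ?H0 ?M0 H1"
  have verts: "pverts ?H0 = {Z 0, U 0, U 1, U 2, Z 2, V 2, V 0}"
    by (simp add: directed_cycle_7 base_cycle_def)
  have path: "pverts ?M0 = {Z 0, U 0, U 1}" "parcs ?M0 = {(Z 0, U 0), (U 0, U 1)}"
    by (simp_all add: directed_path_3 base_cycle_def)
  \<comment> \<open>The arcs of \<open>?M0\<close> lie in the converse of the arc set of
    \<open>H1\<close>, so \<open>H1\<close> passes through the 2-arc in the opposite
    direction.\<close>
  have "(U 1, U 0) \<in> parcs H1" "(U 0, Z 0) \<in> parcs H1"
    using F path(2) unfolding fastened_def by blast+
  then obtain d where d: "embedding (directed_cycle 7) coxeter_digraph d"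
    "H1 = image_digraph d (directed_cycle 7)" "d 0 = U 1" "d 1 = U 0" "d 2 = Z 0"
    using cycle_with_2arc F unfolding fastened_def by metis
  have distinct: "distinct [d 0, d 1, d 2, d 3, d 4, d 5, d 6]"
    and adj: "adj (Z 0) (d 3)" "adj (d 3) (d 4)" "adj (d 4) (d 5)" "adj (d 6) (d 5)"
      "adj (U 1) (d 6)"
    using d by (auto simp: embedding_cycle_7 adj_sym)
  have "pverts ?H0 \<inter> pverts H1 = {Z 0, U 0, U 1}"
    using F by (simp only: fastened_def path)
  moreover have "V 0 \<in> pverts ?H0 - {Z 0, U 0, U 1}" "U 2 \<in> pverts ?H0 - {Z 0, U 0, U 1}"
    unfolding verts by simp_all
  ultimately have "V 0 \<notin> pverts H1" "U 2 \<notin> pverts H1"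
    by blast+
  \<comment> \<open>The indices 3 and 6 belong to the vertices next to the ends \<open>Z 0\<close>
    and \<open>U 1\<close> of the 2-arc.\<close>
  moreover have "d i \<in> pverts H1" if "i \<in> {3, 6}" for i
    using d(2) that by (auto simp: directed_cycle_7)
  ultimately have "d 3 \<noteq> V 0" "d 6 \<noteq> U 2"
    by (metis insertCI)+
  then have "d 3 = T 0" "d 6 = Z 1"
    using adj(1,5) distinct d(3-5) by (auto simp: adj_iff)
  moreover from this have "d 4 \<in> {T 3, T 4}" "d 5 \<in> {V 1, T 1}"
    using adj distinct d(3-5) by (auto simp: adj_iff numeral_7)
  \<comment> \<open>Of the four remaining pairs, only \<open>T 4\<close> and \<open>T 1\<close> are
    adjacent.\<close>
  with adj(3) have "d 4 = T 4" "d 5 = T 1"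
    by (auto simp: adj_iff numeral_7)
  ultimately have "\<forall>v \<in> pverts (directed_cycle 7). d v = second_cycle v"
    using d(3-5) by (intro cycle_7_eqI) (simp_all add: second_cycle_def)
  then show "H1 = image_digraph second_cycle (directed_cycle 7)"
    unfolding d(2) by (intro image_digraph_cong directed_cycle_wf) auto
qed

lemma path_subgraph_cycle: "subgraph (with_proj (directed_path 3)) (with_proj (directed_cycle 7))"
  by (simp add: subgraph_def compatible_def wf_digraph_wp_iff directed_path_wf directed_cycle_wf)
    (simp add: directed_path_3 directed_cycle_7)

theorem theorem2:
  shows "UH_over (directed_cycle 7) (directed_path 3) coxeter_digraph"
  unfolding UH_over_def fastened_def[symmetric]
proof (intro conjI allI impI path_subgraph_cycle UH_path UH_cycle)
  fix H0 M0
  assume H0: "is_copy (directed_cycle 7) coxeter_digraph H0"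
    and M0: "is_copy (directed_path 3) H0 M0"
  \<comment> \<open>Here \<open>H0\<close> is itself the host digraph in which \<open>M0\<close> is
    a copy, so \<open>is_copy_iff\<close> asks for its well-formedness.\<close>
  have "pair_wf_digraph H0"
    using H0 by (simp add: is_copy_def subgraph_def wf_digraph_wp_iff)
  then obtain p where p: "embedding (directed_path 3) H0 p" "M0 = image_digraph p (directed_path 3)"
    using M0 is_copy_iff[OF directed_path_wf] by blast
  have "(p 0, p 1) \<in> parcs H0" "(p 1, p 2) \<in> parcs H0"
    using p(1) by (simp_all add: embedding_def directed_path_3)
  then obtain c where c: "embedding (directed_cycle 7) coxeter_digraph c"
    "H0 = image_digraph c (directed_cycle 7)" "c 0 = p 0" "c 1 = p 1" "c 2 = p 2"
    using cycle_with_2arc[OF H0] by metis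
  obtain g where g: "automorphism coxeter_digraph g"
    "\<And>v. v \<in> pverts (directed_cycle 7) \<Longrightarrow> g (c v) = base_cycle v"
    using automorphism_to_base_cycle[OF c(1)] by blast
  obtain k where k: "automorphism coxeter_digraph k" "\<And>v. k (g v) = v"
    using automorphism_inverse[OF coxeter_wf g(1)] by (metis UNIV_I pverts_coxeter)
  have c_eq: "c v = k (base_cycle v)" if "v \<in> pverts (directed_cycle 7)" for v
    using g(2)[OF that] k(2)[of "c v"] by simp
  have "H0 = image_digraph k (image_digraph base_cycle (directed_cycle 7))"
    unfolding image_digraph_comp c(2) using c_eq
    by (intro image_digraph_cong directed_cycle_wf) simp_all
  \<comment> \<open>The same \<open>k\<close> serves for \<open>M0\<close>, because the cycle was
    indexed so that \<open>c\<close> and \<open>p\<close> agree on 0, 1, 2.\<close>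
  moreover have "M0 = image_digraph k (image_digraph base_cycle (directed_path 3))"
    unfolding image_digraph_comp p(2) using c_eq[of 0] c_eq[of 1] c_eq[of 2] c(3-5)
    by (intro image_digraph_cong directed_path_wf) (auto simp: directed_path_3 directed_cycle_7)
  ultimately show "\<exists>!H1. fastened (directed_cycle 7) coxeter_digraph H0 M0 H1"
    using unique_fastened_automorphism[OF directed_cycle_wf coxeter_wf _ k(1) base_fastened] by simp
qed

end
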